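(* For every positive integer $n$ we have \[ \sum_{m\in \mathbb{Z}} m^2\, r^{\mathrm{e}-\mathrm{o}}\left(n-m^2\right)=\sum_{d\mid n} d\,c_d, \] where the sum on the right runs over the positive divisors $d$ of $n$ and \[ c_n= \begin{cases} 2&\text{if } n\equiv 1 \pmod{2},\\ -3&\text{if } n\equiv 2 \pmod{4},\\ -1&\text{if } n\equiv 0 \pmod{4}. \end{cases} \] Equivalently, writing $n=2^t n'$ with $t\ge 0$ and $2\nmid n'$, we have \[ \sum_{m\in\mathbb{Z}} m^2\, r^{\mathrm{e}-\mathrm{o}}(n-m^2)=\left(2-6\delta_{t>0}\right)\sum_{d\mid n'} d - 4\sum_{d\mid \frac{n}{4}} d. \]
   Context: For an integer $n$, let $r^{\mathrm{e}}(n)$ (resp. $r^{\mathrm{o}}(n)$) be the number of ways to write $n$ as a sum of an even (resp. odd) number of non-zero squares, i.e. the number of pairs consisting of an even (resp. odd) integer $\ell\ge 0$ and an ordered tuple $(m_1,\dots,m_\ell)\in(\mathbb{Z}\setminus\{0\})^\ell$ with $\sum_{j=1}^{\ell} m_j^2=n$. The empty tuple ($\ell=0$) counts as a representation of $0$, so $r^{\mathrm{e}}(0)=1$ and $r^{\mathrm{o}}(0)=0$; both functions vanish at negative integers. Set $r^{\mathrm{e}-\mathrm{o}}(n):=r^{\mathrm{e}}(n)-r^{\mathrm{o}}(n)$. The symbol $\delta_{t>0}$ equals $1$ if $t>0$ and $0$ otherwise. All divisor sums are over positive divisors, and the sum over $d\mid \frac{n}{4}$ is empty (equal to $0$) if $4\nmid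 n$. *)

theory Defs
  imports "HOL-Analysis.Infinite_Sum"
begin

text \<open>
  A pair of a length and a tuple of that length is a single list.  Both sets below are finite:
  a nonzero square is at least 1, so a list in them has length at most \<open>n\<close> and entries of
  absolute value at most \<open>n\<close>.  Hence \<^const>\<open>card\<close> is a genuine count.
\<close>

definition r_even :: "int \<Rightarrow> nat" where
  "r_even n = card {ms :: int list. even (length ms) \<and> (\<forall>m\<in>set ms. m \<noteq> 0) \<and> (\<Sum>m\<leftarrow>ms. m\<^sup>2) = n}"

definition r_odd :: "int \<Rightarrow> nat" where
  "r_odd n = card {ms :: int list. odd (length ms) \<and> (\<forall>m\<in>set ms. m \<noteq> 0) \<and> (\<Sum>m\<leftarrow>ms. m\<^sup>2) = n}"

definition r_even_minus_odd :: "int \<Rightarrow> int" where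
  "r_even_minus_odd n = int (r_even n) - int (r_odd n)"

definition c :: "int \<Rightarrow> int" where
  "c n = (if n mod 2 = 1 then 2 else if n mod 4 = 2 then -3 else -1)"

end

theory Submission
  imports Defs "HOL-Computational_Algebra.Formal_Power_Series"
begin

text \<open>
  Write \<open>\<theta> = \<Sum>m\<in>\<int>. q ^ m\<^sup>2\<close>.  An ordered sum of nonzero squares, counted with sign
  \<open>(-1)\<close> to the number of summands, has generating function
  \<open>\<Sum>l. (-1) ^ l * (\<theta> - 1) ^ l = 1 / \<theta>\<close>; so the left-hand side of the theorem is the coefficient of
  \<open>q ^ n\<close> in \<open>\<theta>* / \<theta>\<close>, where
  \<open>\<theta>* = q * \<theta>' = \<Sum>m. m\<^sup>2 * q ^ m\<^sup>2\<close>.  With \<open>D(n) = \<Sum>d | n. d * c d\<close>, it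
  remains to show that \<open>\<theta> * \<Sum>n>0. D(n) * q ^ n = \<theta>*\<close>,
  or in coefficients

  \<open>\<Sum>m\<^sup>2 < n. D (n - m\<^sup>2) = \<Sum>m\<^sup>2 = n. m\<^sup>2\<close>  for every \<open>n > 0\<close>.

  This recurrence is usually read off from Jacobi's product for \<open>\<theta>\<close>.  Here it is proved by a
  sign-reversing involution in the style of Liouville and Zagier.  First, \<open>D k\<close> is also a sum over
  factorizations \<open>k = d * e\<close> of a weight that is linear in \<open>d\<close> and \<open>e\<close> on each parity class
  (\<open>sum_parity_weight\<close>).  The left-hand side of the recurrence thus becomes a sum over all triples
  \<open>(i, d, e)\<close> with \<open>d, e > 0\<close> and \<open>i\<^sup>2 + d * e = n\<close>.  Such a triple is an indefinite binary quadratic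
  form \<open>d * x\<^sup>2 + 2 * i * x * y - e * y\<^sup>2\<close>, and the substitution \<open>x \<rightarrow> x + y\<close> followed by \<open>i \<rightarrow> -i\<close>
  is the involution \<open>(i, d, e) \<rightarrow> (-i - d, d, e - 2 * i - d)\<close>, which preserves positivity exactly when
  \<open>e > 2 * i + d\<close>.  Adding to the weight a term that is odd in \<open>i\<close>, which does not
  change the total, makes the weight change sign under this involution
  (\<open>sum_lifted_weight_above\<close>).  The reflection \<open>(i, d, e) \<rightarrow> (-i, e, d)\<close> carries the cancellation over to
  \<open>e < 2 * i + d\<close>.  What survives is the boundary \<open>e = 2 * i + d\<close>, on which
  \<open>n = (i + d)\<^sup>2\<close>; it is nonempty only when \<open>n\<close> is a square and then contributes \<open>2 * n\<close>
  (\<open>sum_lifted_weight_boundary\<close>).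
\<close>

section \<open>Bounds on squares\<close>

lemma abs_le_square: "\<bar>m::int\<bar> \<le> m\<^sup>2"
  using self_le_power[of "\<bar>m\<bar>" 2] by (cases "m = 0") auto

lemma finite_squares_le: "finite {m::int. m\<^sup>2 \<le> n}"
proof (rule finite_subset)
  show "{m::int. m\<^sup>2 \<le> n} \<subseteq> {-n..n}"
  proof
    fix m :: int assume "m \<in> {m. m\<^sup>2 \<le> n}"
    hence "m\<^sup>2 \<le> n" by simp
    thus "m \<in> {-n..n}" using abs_le_square[of m] by auto
  qed
qed auto

lemma finite_squares_less: "finite {m::int. m\<^sup>2 < n}"
  by (rule finite_subset[OF _ finite_squares_le[of n]]) auto

section \<open>Signed compositions into squares\<close>

definition square_comps :: "int \<Rightarrow> int list set" where
  "square_comps n = {ms. 0 \<notin> set ms \<and> (\<Sum>m\<leftarrow>ms. m\<^sup>2) = n}"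

lemma sum_squares_bounds:
  fixes ms :: "int list"
  assumes "0 \<notin> set ms"
  shows "int (length ms) \<le> (\<Sum>m\<leftarrow>ms. m\<^sup>2)" "m \<in> set ms \<Longrightarrow> \<bar>m\<bar> \<le> (\<Sum>m\<leftarrow>ms. m\<^sup>2)"
proof -
  show len: "int (length ms) \<le> (\<Sum>m\<leftarrow>ms. m\<^sup>2)"
    using assms
  proof (induction ms)
    case (Cons a ms)
    then show ?case using abs_le_square[of a] by auto
  qed auto
  show "m \<in> set ms \<Longrightarrow> \<bar>m\<bar> \<le> (\<Sum>m\<leftarrow>ms. m\<^sup>2)"
    using assms
  proof (induction ms)
    case (Cons a ms)
    have "0 \<le> (\<Sum>m\<leftarrow>ms. m\<^sup>2)" by (rule sum_list_nonneg) auto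
    with Cons show ?case using abs_le_square[of a] by auto
  qed auto
qed

lemma finite_square_comps: "finite (square_comps n)"
proof (rule finite_subset)
  show "square_comps n \<subseteq> {ms. set ms \<subseteq> {-n..n} \<and> length ms \<le> nat n}"
  proof
    fix ms assume "ms \<in> square_comps n"
    hence ms: "0 \<notin> set ms" "(\<Sum>m\<leftarrow>ms. m\<^sup>2) = n" by (auto simp: square_comps_def)
    have "\<bar>m\<bar> \<le> n" if "m \<in> set ms" for m
      using sum_squares_bounds(2)[OF ms(1) that] ms(2) by simp
    hence "set ms \<subseteq> {-n..n}" by (auto simp: abs_le_iff) fastforce
    moreover have "length ms \<le> nat n"
      using sum_squares_bounds(1)[OF ms(1)] ms(2) by simp
    ultimately show "ms \<in> {ms. set ms \<subseteq> {-n..n} \<and> length ms \<le> nat n}" by simp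
  qed
qed (rule finite_lists_length_le, simp)

lemma r_even_minus_odd_eq_signed_sum:
  "r_even_minus_odd n = (\<Sum>ms\<in>square_comps n. (- 1) ^ length ms)"
proof -
  let ?E = "{ms \<in> square_comps n. even (length ms)}"
  let ?O = "{ms \<in> square_comps n. odd (length ms)}"
  have "(\<Sum>ms\<in>square_comps n. (- 1) ^ length ms :: int) =
        (\<Sum>ms\<in>?E \<union> ?O. (- 1) ^ length ms)"
    by (rule sum.cong) auto
  also have "\<dots> = (\<Sum>ms\<in>?E. (- 1) ^ length ms) + (\<Sum>ms\<in>?O. (- 1) ^ length ms)"
    by (rule sum.union_disjoint) (auto simp: finite_square_comps)
  also have "\<dots> = int (card ?E) - int (card ?O)" by simp
  also have "?E = {ms. even (length ms) \<and> (\<forall>m\<in>set ms. m \<noteq> 0) \<and> (\<Sum>m\<leftarrow>ms. m\<^sup>2) = n}"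
    by (auto simp: square_comps_def)
  also have "?O = {ms. odd (length ms) \<and> (\<forall>m\<in>set ms. m \<noteq> 0) \<and> (\<Sum>m\<leftarrow>ms. m\<^sup>2) = n}"
    by (auto simp: square_comps_def)
  finally show ?thesis by (simp add: r_even_minus_odd_def r_even_def r_odd_def)
qed

lemma square_comps_nonpos: "n < 0 \<Longrightarrow> square_comps n = {}" "square_comps 0 = {[]}"
  using sum_squares_bounds(1) by (fastforce simp: square_comps_def)+

lemma square_comps_rec:
  assumes "n > 0"
  shows "square_comps n =
    (\<lambda>(m, ms). m # ms) ` (SIGMA m : {m. m\<^sup>2 \<le> n} - {0}. square_comps (n - m\<^sup>2))"
proof (intro equalityI subsetI)
  fix ms assume ms: "ms \<in> square_comps n"
  with assms obtain a xs where eq: "ms = a # xs"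
    by (cases ms) (auto simp: square_comps_def)
  with ms have xs: "a \<noteq> 0" "xs \<in> square_comps (n - a\<^sup>2)" by (auto simp: square_comps_def)
  moreover from xs have "a\<^sup>2 \<le> n" using square_comps_nonpos(1)[of "n - a\<^sup>2"] by fastforce
  ultimately show "ms \<in> (\<lambda>(m, ms). m # ms) `
      (SIGMA m : {m. m\<^sup>2 \<le> n} - {0}. square_comps (n - m\<^sup>2))"
    using eq by force
qed (auto simp: square_comps_def)

text \<open>
  Splitting off the first summand shortens a composition by one and so flips its sign; the terms
  with \<open>m \<noteq> 0\<close> therefore cancel the term with \<open>m = 0\<close>.  This is the coefficient form of
  \<open>\<theta> * (1 / \<theta>) = 1\<close>.
\<close>

lemma sum_r_even_minus_odd:
  assumes "n > 0"
  shows "(\<Sum>m | m\<^sup>2 \<le> n. r_even_minus_odd (n - m\<^sup>2)) = 0"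
proof -
  let ?I = "{m. m\<^sup>2 \<le> n}"
  have "r_even_minus_odd n =
      (\<Sum>(m, ms)\<in>(SIGMA m : ?I - {0}. square_comps (n - m\<^sup>2)). - ((- 1) ^ length ms))"
    unfolding r_even_minus_odd_eq_signed_sum square_comps_rec[OF assms]
    by (subst sum.reindex) (auto simp: inj_on_def intro!: sum.cong)
  also have "\<dots> = (\<Sum>m\<in>?I - {0}. \<Sum>ms\<in>square_comps (n - m\<^sup>2). - ((- 1) ^ length ms))"
    by (rule sum.Sigma[symmetric]) (auto simp: finite_squares_le finite_square_comps)
  also have "\<dots> = - (\<Sum>m\<in>?I - {0}. r_even_minus_odd (n - m\<^sup>2))"
    by (simp add: r_even_minus_odd_eq_signed_sum sum_negf)
  finally have "r_even_minus_odd n + (\<Sum>m\<in>?I - {0}. r_even_minus_odd (n - m\<^sup>2)) = 0" by simp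
  moreover have "(\<Sum>m\<in>?I. r_even_minus_odd (n - m\<^sup>2)) =
      r_even_minus_odd (n - 0\<^sup>2) + (\<Sum>m\<in>?I - {0}. r_even_minus_odd (n - m\<^sup>2))"
    by (rule sum.remove) (use assms in \<open>auto simp: finite_squares_le\<close>)
  ultimately show ?thesis by simp
qed

section \<open>Divisor sums\<close>

definition sigma :: "int \<Rightarrow> int" where
  "sigma n = (\<Sum>d | d > 0 \<and> d dvd n. d)"

definition weighted_sigma :: "int \<Rightarrow> int" where
  "weighted_sigma n = (\<Sum>d | d > 0 \<and> d dvd n. d * c d)"

lemma finite_pos_divisors: "n > 0 \<Longrightarrow> finite {d::int. d > 0 \<and> d dvd n}"
  by (rule finite_subset[of _ "{1..n}"]) (auto dest: zdvd_imp_le)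

lemma odd_divisors_two_power_times:
  fixes m :: int
  assumes "odd m"
  shows "{d. (d > 0 \<and> d dvd 2 ^ t * m) \<and> odd d} = {d. d > 0 \<and> d dvd m}"
proof -
  have "d dvd 2 ^ t * m \<longleftrightarrow> d dvd m" if "odd d" for d
  proof -
    have "coprime d (2 ^ t)" using that by simp
    thus ?thesis by (simp add: coprime_dvd_mult_right_iff)
  qed
  thus ?thesis using assms dvd_trans by blast
qed

lemma sum_even_divisors:
  fixes n :: int
  assumes "k > 0" "k dvd n"
  shows "(\<Sum>d | (d > 0 \<and> d dvd n) \<and> k dvd d. f d) = (\<Sum>d | d > 0 \<and> d dvd n div k. f (k * d))"
proof -
  obtain a where n: "n = k * a" using assms by auto
  show ?thesis
    by (rule sum.reindex_bij_witness[of _ "\<lambda>d. k * d" "\<lambda>d. d div k"])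
       (use assms in \<open>auto simp: n zero_less_mult_iff\<close>)
qed

lemma sum_split_parity:
  assumes "n > 0"
  shows "(\<Sum>d | d > 0 \<and> d dvd (n::int). f d) =
    (\<Sum>d | (d > 0 \<and> d dvd n) \<and> odd d. f d) + (\<Sum>d | (d > 0 \<and> d dvd n) \<and> even d. f d)"
proof -
  have "{d. d > 0 \<and> d dvd n} = {d. (d > 0 \<and> d dvd n) \<and> odd d} \<union> {d. (d > 0 \<and> d dvd n) \<and> even d}"
    by auto
  moreover have "sum f \<dots> = (\<Sum>d | (d > 0 \<and> d dvd n) \<and> odd d. f d) + (\<Sum>d | (d > 0 \<and> d dvd n) \<and> even d. f d)"
    by (intro sum.union_disjoint) (auto intro: rev_finite_subset[OF finite_pos_divisors[OF assms]])
  ultimately show ?thesis by simp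
qed

lemma sigma_two_power_times:
  assumes "odd m" "m > 0"
  shows "sigma (2 ^ t * m) = (2 ^ Suc t - 1) * sigma m"
proof (induction t)
  case (Suc t)
  have "sigma (2 ^ Suc t * m) = sigma m + (\<Sum>d | d > 0 \<and> d dvd 2 ^ Suc t * m div 2. 2 * d)"
    unfolding sigma_def
    by (subst sum_split_parity, use assms in simp,
        subst odd_divisors_two_power_times[OF assms(1)], subst sum_even_divisors) auto
  also have "2 ^ Suc t * m div 2 = 2 ^ t * m" by simp
  also have "(\<Sum>d | d > 0 \<and> d dvd 2 ^ t * m. 2 * d) = 2 * sigma (2 ^ t * m)"
    by (simp add: sigma_def sum_distrib_left)
  also have "sigma m + 2 * sigma (2 ^ t * m) = (2 ^ Suc (Suc t) - 1) * sigma m"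
    by (simp only: Suc.IH) (simp add: algebra_simps)
  finally show ?case .
qed simp

text \<open>
  The three residue classes of \<open>c\<close> are separated by splitting off odd divisors twice: odd \<open>d\<close> are the
  divisors of \<open>m\<close>, those with \<open>d mod 4 = 2\<close> are their doubles if \<open>t > 0\<close>, and the multiples of 4 are
  \<open>4 * d\<close> with \<open>d\<close> a divisor of \<open>2 ^ t * m div 4\<close>.
\<close>

lemma weighted_sigma_eq:
  assumes "odd m" "m > 0"
  shows "weighted_sigma (2 ^ t * m) =
    (2 - 6 * of_bool (t > 0)) * sigma m - 4 * (if 4 dvd 2 ^ t * m then sigma (2 ^ t * m div 4) else 0)"
proof -
  let ?n = "2 ^ t * m"
  have n: "?n > 0" using assms by simp
  have odd: "(\<Sum>d | (d > 0 \<and> d dvd ?n) \<and> odd d. d * c d) = 2 * sigma m"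
  proof -
    have "(\<Sum>d | (d > 0 \<and> d dvd ?n) \<and> odd d. d * c d) = (\<Sum>d | (d > 0 \<and> d dvd ?n) \<and> odd d. 2 * d)"
      by (rule sum.cong) (auto simp: c_def odd_iff_mod_2_eq_one)
    thus ?thesis
      by (simp only: odd_divisors_two_power_times[OF assms(1)] sigma_def sum_distrib_left)
  qed
  have even: "(\<Sum>d | (d > 0 \<and> d dvd ?n) \<and> even d. d * c d) =
      (if t > 0 then - 6 * sigma m else 0) - 4 * (if 4 dvd ?n then sigma (?n div 4) else 0)"
  proof (cases t)
    case 0
    hence "{d. (d > 0 \<and> d dvd ?n) \<and> even d} = {}" using assms dvd_trans by auto
    moreover have "\<not> 4 dvd ?n"
    proof
      assume "4 dvd ?n"
      hence "4 dvd m" using 0 by simp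
      thus False using assms by presburger
    qed
    ultimately show ?thesis using 0 by (simp only: sum.empty) auto
  next
    case (Suc s)
    let ?k = "2 ^ s * m"
    have n_eq: "?n = 2 * ?k" using Suc by simp
    have k: "?n div 2 = ?k" "?k > 0" using Suc assms by auto
    have "4 dvd 2 * x \<longleftrightarrow> even x" for x :: int by presburger
    hence four_dvd: "4 dvd ?n \<longleftrightarrow> even ?k" by (simp only: n_eq)
    have "(\<Sum>d | (d > 0 \<and> d dvd ?n) \<and> even d. d * c d) = (\<Sum>d | d > 0 \<and> d dvd ?k. 2 * d * c (2 * d))"
      using Suc k by (subst sum_even_divisors) auto
    also have "\<dots> = (\<Sum>d | (d > 0 \<and> d dvd ?k) \<and> odd d. 2 * d * c (2 * d)) +
        (\<Sum>d | (d > 0 \<and> d dvd ?k) \<and> even d. 2 * d * c (2 * d))"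
      by (rule sum_split_parity) (rule k)
    also have "(\<Sum>d | (d > 0 \<and> d dvd ?k) \<and> odd d. 2 * d * c (2 * d)) =
        (\<Sum>d | (d > 0 \<and> d dvd ?k) \<and> odd d. - 6 * d)"
    proof (rule sum.cong)
      fix d :: int assume "d \<in> {d. (d > 0 \<and> d dvd ?k) \<and> odd d}"
      hence "odd d" by simp
      hence "(2 * d) mod 2 = 0" "(2 * d) mod 4 = 2" by presburger+
      thus "2 * d * c (2 * d) = - 6 * d" by (simp add: c_def)
    qed simp
    also have "\<dots> = - 6 * sigma m"
      by (simp only: odd_divisors_two_power_times[OF assms(1)] sigma_def sum_distrib_left)
    also have "(\<Sum>d | (d > 0 \<and> d dvd ?k) \<and> even d. 2 * d * c (2 * d)) =
        (\<Sum>d | (d > 0 \<and> d dvd ?k) \<and> even d. - 2 * d)"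
      by (rule sum.cong) (auto simp: c_def)
    also have "\<dots> = - 4 * (if 4 dvd ?n then sigma (?n div 4) else 0)"
    proof (cases "even ?k")
      case True
      hence "(\<Sum>d | (d > 0 \<and> d dvd ?k) \<and> even d. - 2 * d) = (\<Sum>d | d > 0 \<and> d dvd ?k div 2. - 2 * (2 * d))"
        by (intro sum_even_divisors) auto
      also have "\<dots> = - 4 * sigma (?k div 2)" by (simp add: sigma_def sum_distrib_left)
      also have "?k div 2 = ?n div 4"
      proof -
        have "x div 2 = (2 * x) div 4" for x :: int by presburger
        with n_eq show ?thesis by metis
      qed
      finally show ?thesis using four_dvd True by (simp only: if_True)
    next
      case False
      hence "{d. (d > 0 \<and> d dvd ?k) \<and> even d} = {}" using dvd_trans by blast
      moreover have "\<not> 4 dvd ?n" using False four_dvd by blast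
      ultimately show ?thesis by (simp only: sum.empty) auto
    qed
    finally show ?thesis using Suc by simp
  qed
  show ?thesis
    unfolding weighted_sigma_def sum_split_parity[OF n] odd even by (simp add: algebra_simps)
qed

section \<open>Weighted divisor sums as sums over factorizations\<close>

text \<open>
  Many weights on factorizations have the sum \<open>weighted_sigma\<close>.  This one can be made antisymmetric
  under the involution on triples by a correction term odd in \<open>i\<close>; it is found by taking a general
  linear form in \<open>i, d, e\<close> on each parity class and solving for antisymmetry.
\<close>

definition parity_weight :: "int \<Rightarrow> int \<Rightarrow> int" where
  "parity_weight d e =
    (if odd d then if odd e then d + e else - e else if odd e then - d else 0)"

lemma sum_factorizations:
  fixes n :: int
  assumes "n > 0"
  shows "(\<Sum>(d, e) | d > 0 \<and> e > 0 \<and> d * e = n. f d e) = (\<Sum>d | d > 0 \<and> d dvd n. f d (n div d))"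
  by (rule sum.reindex_bij_witness[of _ "\<lambda>d. (d, n div d)" fst])
     (use assms in \<open>auto simp: zero_less_mult_iff pos_imp_zdiv_pos_iff zdvd_imp_le\<close>)

lemma sum_codivisors:
  fixes n :: int
  assumes "n > 0"
  shows "(\<Sum>d | d > 0 \<and> d dvd n. f (n div d)) = (\<Sum>d | d > 0 \<and> d dvd n. f d)"
  by (rule sum.reindex_bij_witness[of _ "\<lambda>d. n div d" "\<lambda>d. n div d"])
     (use assms in \<open>auto simp: pos_imp_zdiv_pos_iff zdvd_imp_le elim!: dvdE\<close>)

lemma weighted_sigma_odd:
  assumes "odd n" "n > 0"
  shows "weighted_sigma n = 2 * sigma n"
proof -
  have "\<not> 4 dvd n" using assms by presburger
  thus ?thesis using weighted_sigma_eq[OF assms, of 0] by simp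
qed

lemma weighted_sigma_even:
  assumes "odd m" "m > 0"
  shows "weighted_sigma (2 ^ Suc t * m) = - 4 * 2 ^ t * sigma m"
proof (cases t)
  case 0
  hence "\<not> 4 dvd 2 ^ Suc t * m" using assms by simp presburger
  thus ?thesis using weighted_sigma_eq[OF assms, of "Suc t"] 0 by simp
next
  case (Suc s)
  have eq: "2 ^ Suc t * m = 4 * (2 ^ s * m)" using Suc by simp
  have "weighted_sigma (2 ^ Suc t * m) = - 4 * sigma m - 4 * sigma (2 ^ s * m)"
    using weighted_sigma_eq[OF assms, of "Suc t"] unfolding eq by simp
  thus ?thesis unfolding sigma_two_power_times[OF assms] by (simp add: Suc algebra_simps)
qed

text \<open>
  For odd \<open>n\<close> both sides are \<open>2 * sigma n\<close>.  For \<open>n = 2 ^ t * m\<close> with \<open>t > 0\<close> only factorizations with one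
  odd factor count, and the other factor is then \<open>2 ^ t\<close> times a divisor of \<open>m\<close>; so the left-hand side is
  \<open>- 2 * 2 ^ t * sigma m\<close>, which is the value found in \<open>weighted_sigma_even\<close>.
\<close>

lemma sum_parity_weight:
  assumes "n > 0"
  shows "(\<Sum>(d, e) | d > 0 \<and> e > 0 \<and> d * e = n. parity_weight d e) = weighted_sigma n"
proof -
  obtain m where "n = 2 ^ multiplicity 2 n * m" "odd m"
    by (rule multiplicity_decompose'[of n 2]) (use assms in auto)
  then obtain t where m: "n = 2 ^ t * m" "odd m" by blast
  hence "m > 0" using assms by (simp add: zero_less_mult_iff)
  have "(\<Sum>d | d > 0 \<and> d dvd n. parity_weight d (n div d)) = weighted_sigma n"
  proof (cases t)
    case 0
    have "(\<Sum>d | d > 0 \<and> d dvd n. parity_weight d (n div d)) =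
        (\<Sum>d | d > 0 \<and> d dvd n. d + n div d)"
      using m(2) 0 m(1) by (intro sum.cong) (auto simp: parity_weight_def elim!: dvdE)
    also have "\<dots> = 2 * sigma n"
      using sum_codivisors[OF assms, of "\<lambda>d. d"] by (simp add: sum.distrib sigma_def)
    finally show ?thesis using weighted_sigma_odd[of n] m 0 assms by simp
  next
    case (Suc s)
    \<comment> \<open>\<open>h d\<close> is the part of the weight carried by factorizations with odd first factor; those with
      odd second factor are the same ones transposed.\<close>
    define h where "h = (\<lambda>d. if odd d then n div d else 0)"
    have h: "(\<Sum>d | d > 0 \<and> d dvd n. h d) = 2 ^ t * sigma m"
    proof -
      have "(\<Sum>d | d > 0 \<and> d dvd n. h d) = (\<Sum>d | (d > 0 \<and> d dvd n) \<and> odd d. n div d)"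
        unfolding h_def using finite_pos_divisors[OF assms]
        by (subst sum.inter_filter[symmetric]) auto
      also have "\<dots> = (\<Sum>d | d > 0 \<and> d dvd m. n div d)"
        by (simp only: m(1) odd_divisors_two_power_times[OF m(2)])
      also have "\<dots> = (\<Sum>d | d > 0 \<and> d dvd m. 2 ^ t * (m div d))"
        using m(1) by (intro sum.cong) (auto simp: div_mult_swap)
      also have "\<dots> = 2 ^ t * sigma m"
        using sum_codivisors[OF \<open>m > 0\<close>, of "\<lambda>d. d"]
        by (simp add: sigma_def sum_distrib_left[symmetric])
      finally show ?thesis .
    qed
    have "even n" using m Suc by simp
    have "(\<Sum>d | d > 0 \<and> d dvd n. parity_weight d (n div d)) =
        (\<Sum>d | d > 0 \<and> d dvd n. - h d - h (n div d))"
    proof (rule sum.cong)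
      fix d assume "d \<in> {d. d > 0 \<and> d dvd n}"
      then obtain e where "n = d * e" "d > 0" "e > 0" "even d \<or> even e"
        using \<open>even n\<close> assms by (auto simp: zero_less_mult_iff elim!: dvdE[of d])
      thus "parity_weight d (n div d) = - h d - h (n div d)"
        by (auto simp: parity_weight_def h_def)
    qed simp
    also have "\<dots> = - 2 * (2 ^ t * sigma m)"
      using h sum_codivisors[OF assms, of h] by (simp add: sum_subtractf sum_negf)
    also have "\<dots> = weighted_sigma n"
      using weighted_sigma_even[OF m(2) \<open>m > 0\<close>, of s] m(1) Suc by simp
    finally show ?thesis .
  qed
  thus ?thesis by (simp only: sum_factorizations[OF assms])
qed

section \<open>The involution on representations by \<open>i\<^sup>2 + d * e\<close>\<close>

definition triples :: "int \<Rightarrow> (int \<times> int \<times> int) set" where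
  "triples n = {(i, d, e). d > 0 \<and> e > 0 \<and> i\<^sup>2 + d * e = n}"

text \<open>
  The multiple of \<open>i\<close> is forced by the involution \<open>(i, d, e) \<rightarrow> (-i - d, d, e - 2 * i - d)\<close>: for \<open>d\<close> odd
  and \<open>e\<close> even, the last two entries of the image are both odd, so that it has weight \<open>e - 2 * i\<close>, and
  the weight of \<open>(i, d, e)\<close> has to be \<open>2 * i - e\<close>.  The coefficient for \<open>d\<close> even and \<open>e\<close> odd then follows
  from the reflection \<open>(i, d, e) \<rightarrow> (-i, e, d)\<close>.
\<close>

definition lifted_weight :: "int \<times> int \<times> int \<Rightarrow> int" where
  "lifted_weight = (\<lambda>(i, d, e). parity_weight d e + i *
     (if odd d \<and> even e then 2 else if even d \<and> odd e then - 2 else 0))"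

lemma triples_eq_Sigma:
  "triples n = (SIGMA i : {i. i\<^sup>2 < n}. {(d, e). d > 0 \<and> e > 0 \<and> d * e = n - i\<^sup>2})"
proof -
  have "i\<^sup>2 < n" if "d > 0" "e > 0" "i\<^sup>2 + d * e = n" for i d e :: int
    using mult_pos_pos[OF that(1,2)] that(3) by linarith
  thus ?thesis by (auto simp: triples_def)
qed

lemma finite_factorizations: "finite {(d::int, e). d > 0 \<and> e > 0 \<and> d * e = k}"
proof (cases "k > 0")
  case True
  have "{(d, e). d > 0 \<and> e > 0 \<and> d * e = k} \<subseteq> {1..k} \<times> {1..k}"
    by (auto simp: mult_le_cancel_left1 mult_le_cancel_right1)
  thus ?thesis by (rule finite_subset) simp
next
  case False
  hence "{(d, e). d > 0 \<and> e > 0 \<and> d * e = k} = {}" using mult_pos_pos by fastforce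
  thus ?thesis by (simp only: finite.emptyI)
qed

lemma finite_triples: "finite (triples n)"
  unfolding triples_eq_Sigma by (intro finite_SigmaI finite_squares_less finite_factorizations)

lemma sum_eq_0_by_involution:
  fixes f :: "'a \<Rightarrow> int"
  assumes "\<And>x. x \<in> A \<Longrightarrow> h x \<in> A" "\<And>x. x \<in> A \<Longrightarrow> h (h x) = x" "\<And>x. x \<in> A \<Longrightarrow> f (h x) = - f x"
  shows "sum f A = 0"
proof -
  have "sum f A = (\<Sum>x\<in>A. - f x)"
    by (rule sum.reindex_bij_witness[of _ h h]) (use assms in auto)
  thus ?thesis by (simp add: sum_negf)
qed

text \<open>
  If \<open>d\<close> is even, the involution keeps all parities, and the weight is \<open>0\<close> or \<open>-(2 * i + d)\<close>, which
  changes sign.  If \<open>d\<close> is odd, it exchanges the two parities of \<open>e\<close>, and the weights \<open>d + e\<close> and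
  \<open>2 * i - e\<close> are exchanged up to sign.
\<close>

lemma sum_lifted_weight_above:
  "(\<Sum>x | x \<in> triples n \<and> (case x of (i, d, e) \<Rightarrow> e > 2 * i + d). lifted_weight x) = 0"
  by (rule sum_eq_0_by_involution[where h = "\<lambda>(i, d, e). (- i - d, d, e - 2 * i - d)"])
     (auto simp: triples_def lifted_weight_def parity_weight_def power2_eq_square algebra_simps)

lemma sum_lifted_weight_below:
  "(\<Sum>x | x \<in> triples n \<and> (case x of (i, d, e) \<Rightarrow> e < 2 * i + d). lifted_weight x) = 0"
proof -
  let ?r = "\<lambda>(i, d, e). (- i, e, d) :: int \<times> int \<times> int"
  have "(\<Sum>x | x \<in> triples n \<and> (case x of (i, d, e) \<Rightarrow> e < 2 * i + d). lifted_weight x) =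
      (\<Sum>x | x \<in> triples n \<and> (case x of (i, d, e) \<Rightarrow> e > 2 * i + d). lifted_weight x)"
    by (rule sum.reindex_bij_witness[of _ ?r ?r])
       (auto simp: triples_def lifted_weight_def parity_weight_def algebra_simps)
  thus ?thesis by (simp add: sum_lifted_weight_above)
qed

text \<open>
  On the boundary \<open>n = (i + d)\<^sup>2\<close> with \<open>i + d > 0\<close>, so the triples are \<open>(s - d, d, 2 * s - d)\<close> with
  \<open>s = sqrt n\<close> and \<open>0 < d < 2 * s\<close>.  Those with \<open>d\<close> odd have weight \<open>2 * s\<close>, and there are \<open>s\<close> of them.
\<close>

lemma sum_lifted_weight_boundary:
  assumes "n > 0"
  shows "(\<Sum>x | x \<in> triples n \<and> (case x of (i, d, e) \<Rightarrow> e = 2 * i + d). lifted_weight x) =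
    (\<Sum>m | m\<^sup>2 = n. m\<^sup>2)"
proof -
  let ?C = "{x \<in> triples n. case x of (i, d, e) \<Rightarrow> e = 2 * i + d}"
  have C: "(i + d)\<^sup>2 = n \<and> i + d > 0" if "(i, d, e) \<in> ?C" for i d e
    using that by (auto simp: triples_def power2_eq_square algebra_simps)
  show ?thesis
  proof (cases "\<exists>m. m\<^sup>2 = n")
    case False
    hence "?C = {}" using C by auto
    moreover have "{m. m\<^sup>2 = n} = {}" using False by auto
    ultimately show ?thesis by (simp only: sum.empty)
  next
    case True
    then obtain m where "m\<^sup>2 = n" by blast
    define s where "s = \<bar>m\<bar>"
    have s: "s\<^sup>2 = n" "s > 0" using \<open>m\<^sup>2 = n\<close> assms by (auto simp: s_def)
    have "?C = (\<lambda>d. (s - d, d, 2 * s - d)) ` {0<..<2 * s}"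
    proof (intro equalityI subsetI)
      fix x assume x: "x \<in> ?C"
      obtain i d e where eq: "x = (i, d, e)" by (cases x)
      have "i + d = s" by (rule power2_eq_imp_eq) (use C[of i d e] x eq s in auto)
      with x eq show "x \<in> (\<lambda>d. (s - d, d, 2 * s - d)) ` {0<..<2 * s}"
        by (auto simp: triples_def image_iff)
    qed (use s in \<open>auto simp: triples_def power2_eq_square algebra_simps\<close>)
    hence "sum lifted_weight ?C = (\<Sum>d\<in>{0<..<2 * s}. lifted_weight (s - d, d, 2 * s - d))"
      by (simp add: sum.reindex inj_on_def)
    also have "\<dots> = (\<Sum>d\<in>{0<..<2 * s}. if odd d then 2 * s else 0)"
      by (rule sum.cong) (auto simp: lifted_weight_def parity_weight_def)
    also have "\<dots> = (\<Sum>d | d \<in> {0<..<2 * s} \<and> odd d. 2 * s)"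
      by (subst sum.inter_filter) auto
    also have "{d. d \<in> {0<..<2 * s} \<and> odd d} = (\<lambda>k. 2 * k + 1) ` {0..<s}"
      by (auto simp: image_iff elim!: oddE)
    also have "(\<Sum>d\<in>(\<lambda>k. 2 * k + 1) ` {0..<s}. 2 * s) = 2 * s\<^sup>2"
      using s by (simp add: card_image inj_on_def power2_eq_square)
    also have "\<dots> = (\<Sum>m\<in>{s, - s}. m\<^sup>2)" using s by simp
    also have "{s, - s} = {m. m\<^sup>2 = n}" by (auto simp: s(1)[symmetric] power2_eq_iff)
    finally show ?thesis .
  qed
qed

lemma sum_lifted_weight:
  assumes "n > 0"
  shows "sum lifted_weight (triples n) = (\<Sum>m | m\<^sup>2 = n. m\<^sup>2)"
proof -
  let ?A = "{x \<in> triples n. case x of (i, d, e) \<Rightarrow> e > 2 * i + d}"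
  let ?B = "{x \<in> triples n. case x of (i, d, e) \<Rightarrow> e < 2 * i + d}"
  let ?C = "{x \<in> triples n. case x of (i, d, e) \<Rightarrow> e = 2 * i + d}"
  have "triples n = (?A \<union> ?B) \<union> ?C" by auto
  hence "sum lifted_weight (triples n) = sum lifted_weight ((?A \<union> ?B) \<union> ?C)" by (rule arg_cong)
  also have "\<dots> = sum lifted_weight ?A + sum lifted_weight ?B + sum lifted_weight ?C"
    using finite_triples[of n]
    by (subst sum.union_disjoint, simp, simp, force, subst sum.union_disjoint) auto
  finally show ?thesis
    by (simp only: sum_lifted_weight_above sum_lifted_weight_below
          sum_lifted_weight_boundary[OF assms])
qed

text \<open>The Liouville-type recurrence, the coefficient form of \<open>\<theta> * D = q * \<theta>'\<close>.\<close>

lemma sum_weighted_sigma: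
  assumes "n > 0"
  shows "(\<Sum>m | m\<^sup>2 < n. weighted_sigma (n - m\<^sup>2)) = (\<Sum>m | m\<^sup>2 = n. m\<^sup>2)"
proof -
  let ?q = "\<lambda>d e :: int. if odd d \<and> even e then 2 else if even d \<and> odd e then - 2 else (0::int)"
  have "(\<Sum>m | m\<^sup>2 < n. weighted_sigma (n - m\<^sup>2)) =
      (\<Sum>m | m\<^sup>2 < n. \<Sum>(d, e) | d > 0 \<and> e > 0 \<and> d * e = n - m\<^sup>2. parity_weight d e)"
    by (rule sum.cong) (auto simp: sum_parity_weight)
  also have "\<dots> = (\<Sum>(i, d, e)\<in>triples n. parity_weight d e)"
    unfolding triples_eq_Sigma
    by (rule sum.Sigma) (auto simp: finite_squares_less finite_factorizations)
  \<comment> \<open>The correction term is odd in \<open>i\<close>, so it sums to zero.\<close>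
  also have "\<dots> = (\<Sum>(i, d, e)\<in>triples n. parity_weight d e) + (\<Sum>(i, d, e)\<in>triples n. i * ?q d e)"
  proof -
    have "(\<Sum>(i, d, e)\<in>triples n. i * ?q d e) = 0"
      by (rule sum_eq_0_by_involution[where h = "\<lambda>(i, d, e). (- i, d, e)"])
         (auto simp: triples_def)
    thus ?thesis by simp
  qed
  also have "\<dots> = sum lifted_weight (triples n)"
    by (simp add: lifted_weight_def case_prod_unfold sum.distrib)
  finally show ?thesis using sum_lifted_weight[OF assms] by simp
qed

section \<open>Generating functions\<close>

definition theta :: "(int \<Rightarrow> int) \<Rightarrow> int fps" where
  "theta w = Abs_fps (\<lambda>k. \<Sum>m | m\<^sup>2 = int k. w m)"

lemma theta_mult_nth:
  "fps_nth (theta w * Abs_fps (\<lambda>k. f (int k))) n = (\<Sum>m | m\<^sup>2 \<le> int n. w m * f (int n - m\<^sup>2))"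
proof -
  have "fps_nth (theta w * Abs_fps (\<lambda>k. f (int k))) n =
      (\<Sum>k\<in>{0..n}. \<Sum>m | m \<in> {m. m\<^sup>2 \<le> int n} \<and> nat (m\<^sup>2) = k. w m * f (int n - m\<^sup>2))"
    unfolding fps_mult_nth theta_def fps_nth_Abs_fps sum_distrib_right
  proof (intro sum.cong refl)
    fix k x assume k: "k \<in> {0..n}"
    show "{m. m\<^sup>2 = int k} = {m. m \<in> {m. m\<^sup>2 \<le> int n} \<and> nat (m\<^sup>2) = k}" using k by auto
    assume "x \<in> {m. m \<in> {m. m\<^sup>2 \<le> int n} \<and> nat (m\<^sup>2) = k}"
    thus "w x * f (int (n - k)) = w x * f (int n - x\<^sup>2)" using k by (auto simp: of_nat_diff)
  qed
  also have "\<dots> = (\<Sum>m | m\<^sup>2 \<le> int n. w m * f (int n - m\<^sup>2))"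
    by (rule sum.group) (auto simp: finite_squares_le nat_le_iff)
  finally show ?thesis .
qed

lemma theta_mult_r: "theta (\<lambda>_. 1) * Abs_fps (\<lambda>k. r_even_minus_odd (int k)) = 1"
proof (rule fps_ext)
  fix n :: nat
  show "fps_nth (theta (\<lambda>_. 1) * Abs_fps (\<lambda>k. r_even_minus_odd (int k))) n = fps_nth 1 n"
  proof (cases "n = 0")
    case True
    thus ?thesis
      by (simp only: theta_mult_nth) (simp add: r_even_minus_odd_eq_signed_sum square_comps_nonpos(2))
  next
    case False
    thus ?thesis by (simp only: theta_mult_nth) (simp add: sum_r_even_minus_odd)
  qed
qed

text \<open>
  The constant coefficient is set to \<open>0\<close> because every positive integer divides \<open>0\<close>, so that
  \<open>weighted_sigma 0\<close> has no meaning as a divisor sum.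
\<close>

lemma theta_mult_weighted_sigma:
  "theta (\<lambda>_. 1) * Abs_fps (\<lambda>k. if int k = 0 then 0 else weighted_sigma (int k)) = theta (\<lambda>m. m\<^sup>2)"
proof (rule fps_ext)
  fix n :: nat
  let ?f = "\<lambda>k. if k = 0 then 0 else weighted_sigma k"
  have "fps_nth (theta (\<lambda>_. 1) * Abs_fps (\<lambda>k. ?f (int k))) n = (\<Sum>m | m\<^sup>2 \<le> int n. ?f (int n - m\<^sup>2))"
    by (simp only: theta_mult_nth[of "\<lambda>_. 1" ?f n] mult_1)
  also have "\<dots> = (\<Sum>m | m\<^sup>2 < int n. weighted_sigma (int n - m\<^sup>2))"
    by (rule sum.mono_neutral_cong_right) (auto simp: finite_squares_le)
  also have "\<dots> = (\<Sum>m | m\<^sup>2 = int n. m\<^sup>2)"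
    by (cases "n = 0") (simp_all add: sum_weighted_sigma)
  finally show "fps_nth (theta (\<lambda>_. 1) * Abs_fps (\<lambda>k. ?f (int k))) n = fps_nth (theta (\<lambda>m. m\<^sup>2)) n"
    by (simp add: theta_def)
qed

text \<open>Both \<open>theta_mult_r\<close> and \<open>theta_mult_weighted_sigma\<close> enter: \<open>\<theta>* * (1 / \<theta>) = (\<theta> * (1 / \<theta>)) * D = D\<close>.\<close>

lemma sum_squares_r_even_minus_odd:
  assumes "n > 0"
  shows "(\<Sum>m | m\<^sup>2 \<le> n. m\<^sup>2 * r_even_minus_odd (n - m\<^sup>2)) = weighted_sigma n"
proof -
  let ?R = "Abs_fps (\<lambda>k. r_even_minus_odd (int k))"
  let ?D = "Abs_fps (\<lambda>k. if int k = 0 then 0 else weighted_sigma (int k))"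
  have "theta (\<lambda>m. m\<^sup>2) * ?R = (theta (\<lambda>_. 1) * ?R) * ?D"
    by (simp only: theta_mult_weighted_sigma[symmetric] mult_ac)
  hence "fps_nth (theta (\<lambda>m. m\<^sup>2) * ?R) (nat n) = fps_nth ?D (nat n)"
    by (simp only: theta_mult_r mult_1)
  thus ?thesis using assms by (simp only: theta_mult_nth) simp
qed

theorem theorem1p1:
  fixes n :: int
  assumes "n > 0"
  shows "((\<lambda>m::int. m\<^sup>2 * r_even_minus_odd (n - m\<^sup>2)) has_sum
            (\<Sum>d | d > 0 \<and> d dvd n. d * c d)) UNIV
       \<and> (\<forall>(t::nat) (n'::int). n = 2 ^ t * n' \<and> \<not> 2 dvd n' \<longrightarrow>
            ((\<lambda>m::int. m\<^sup>2 * r_even_minus_odd (n - m\<^sup>2)) has_sum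
              ((2 - 6 * of_bool (t > 0)) * (\<Sum>d | d > 0 \<and> d dvd n'. d)
                - 4 * (if 4 dvd n then \<Sum>d | d > 0 \<and> d dvd n div 4. d else 0))) UNIV)"
proof -
  have "((\<lambda>m. m\<^sup>2 * r_even_minus_odd (n - m\<^sup>2)) has_sum
      (\<Sum>m | m\<^sup>2 \<le> n. m\<^sup>2 * r_even_minus_odd (n - m\<^sup>2))) UNIV"
    by (rule has_sum_finite_neutralI)
       (auto simp: finite_squares_le r_even_minus_odd_eq_signed_sum square_comps_nonpos(1))
  hence has_sum: "((\<lambda>m. m\<^sup>2 * r_even_minus_odd (n - m\<^sup>2)) has_sum weighted_sigma n) UNIV"
    by (simp only: sum_squares_r_even_minus_odd[OF assms])
  show ?thesis
  proof (intro conjI allI impI)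
    show "((\<lambda>m. m\<^sup>2 * r_even_minus_odd (n - m\<^sup>2)) has_sum (\<Sum>d | d > 0 \<and> d dvd n. d * c d)) UNIV"
      using has_sum by (simp only: weighted_sigma_def)
    fix t n' assume n': "n = 2 ^ t * n' \<and> \<not> 2 dvd n'"
    hence "weighted_sigma n = (2 - 6 * of_bool (t > 0)) * (\<Sum>d | d > 0 \<and> d dvd n'. d)
        - 4 * (if 4 dvd n then \<Sum>d | d > 0 \<and> d dvd n div 4. d else 0)"
      using weighted_sigma_eq[of n' t] assms by (simp add: sigma_def zero_less_mult_iff)
    with has_sum show "((\<lambda>m. m\<^sup>2 * r_even_minus_odd (n - m\<^sup>2)) has_sum
        ((2 - 6 * of_bool (t > 0)) * (\<Sum>d | d > 0 \<and> d dvd n'. d)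
          - 4 * (if 4 dvd n then \<Sum>d | d > 0 \<and> d dvd n div 4. d else 0))) UNIV"
      by (simp only:)
  qed
qed

end
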